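(* Let $W=M_uC_\varphi$ be a bounded weighted composition operator on the infinite dimensional Hilbert space $L^2(\mu)$, let $J=hE(|u|^2)\circ\varphi^{-1}$, and let $0<\lambda\leq1$. If $S(u)\subseteq S(J)$ and $(h\circ\varphi)\,E\left(\frac{|u|^2}{J}\right)\leq\lambda$ $\mu$-a.e., then $W$ is not weakly hypercyclic.
   Context: $(X,\mathcal{F},\mu)$ is a $\sigma$-finite measure space, $L^2(\mu)$ is the complex $L^2$ space, $\varphi:X\to X$ is a non-singular measurable transformation (i.e. $\mu\circ\varphi^{-1}\ll\mu$) such that $\mu$ restricted to $\varphi^{-1}(\mathcal{F})$ is $\sigma$-finite, and $u:X\to[0,\infty)$ is measurable. The weighted composition operator is $Wf=M_uC_\varphi f=u\cdot(f\circ\varphi)$. Here $h=\frac{d\mu\circ\varphi^{-1}}{d\mu}$ is the Radon-Nikodym derivative and $E$ is the conditional expectation with respect to the $\sigma$-subalgebra $\varphi^{-1}(\mathcal{F})$: for nonnegative measurable $f$, $E(f)$ is the a.e. unique $\varphi^{-1}(\mathcal{F})$-measurable function with values in $[0,\infty]$ such that $\int_B E(f)\,d\mu=\int_B f\,d\mu$ for all $B\in\varphi^{-1}(\mathcal{F})$. Since $E(f)$ has the form $g\circ\varphi$ with $g$ $\mathcal{F}$-measurable and determined a.e. on $\{h\neq0\}$, $hE(f)\circ\varphi^{-1}$ denotes the function $h\cdot g$. Thus $J=hE(|u|^2)\circ\varphi^{-1}$ is the ($\mu$-a.e. unique) nonnegative measurable function with $\int_A J\,d\mu=\int_{\varphi^{-1}(A)}|u|^2\,d\mu$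 for all $A\in\mathcal{F}$. For a measurable function $f$, $S(f)=\{x\in X: f(x)\neq0\}$ is its support; inclusions of such sets are understood up to $\mu$-null sets. The quotient $\frac{|u|^2}{J}$ is taken to be $0$ off $S(u)$. A bounded operator $T$ on a Hilbert space $\mathcal{H}$ is weakly hypercyclic if there is $x\in\mathcal{H}$ such that $\{T^nx:n\geq0\}$ is dense in $\mathcal{H}$ in the weak topology. *)

theory Defs
  imports "HOL-Probability.Probability"
begin

section \<open>The complex space \<open>L\<^sup>2(\<mu>)\<close>\<close>

text \<open>
  The elements of \<open>L\<^sup>2(\<mu>)\<close> are the classes of square-integrable functions modulo equality
  \<open>\<mu>\<close>-almost everywhere.  The class of a function that is not square-integrable is \<open>{}\<close>, which
  is not an element of \<open>L2 M\<close>.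
\<close>

definition L2_fun :: "'a measure \<Rightarrow> ('a \<Rightarrow> complex) set" where
  "L2_fun M = {f \<in> borel_measurable M. integrable M (\<lambda>x. (cmod (f x))\<^sup>2)}"

definition L2_rel :: "'a measure \<Rightarrow> (('a \<Rightarrow> complex) \<times> ('a \<Rightarrow> complex)) set" where
  "L2_rel M = {(f, g). f \<in> L2_fun M \<and> g \<in> L2_fun M \<and> (AE x in M. f x = g x)}"

definition L2 :: "'a measure \<Rightarrow> ('a \<Rightarrow> complex) set set" where
  "L2 M = L2_fun M // L2_rel M"

definition L2_class :: "'a measure \<Rightarrow> ('a \<Rightarrow> complex) \<Rightarrow> ('a \<Rightarrow> complex) set" where
  "L2_class M f = L2_rel M `` {f}"

text \<open>
  The unions in the following definitions are over representatives.  They are unions of equal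
  classes: the operations respect equality almost everywhere.
\<close>

definition L2_add ::
    "'a measure \<Rightarrow> ('a \<Rightarrow> complex) set \<Rightarrow> ('a \<Rightarrow> complex) set \<Rightarrow> ('a \<Rightarrow> complex) set" where
  "L2_add M F G = (\<Union>f\<in>F. \<Union>g\<in>G. L2_class M (\<lambda>x. f x + g x))"

definition L2_scale :: "'a measure \<Rightarrow> complex \<Rightarrow> ('a \<Rightarrow> complex) set \<Rightarrow> ('a \<Rightarrow> complex) set" where
  "L2_scale M c F = (\<Union>f\<in>F. L2_class M (\<lambda>x. c * f x))"

definition L2_norm :: "'a measure \<Rightarrow> ('a \<Rightarrow> complex) set \<Rightarrow> real" where
  "L2_norm M F = the_elem ((\<lambda>f. sqrt (\<integral>x. (cmod (f x))\<^sup>2 \<partial>M)) ` F)"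

definition L2_infinite_dimensional :: "'a measure \<Rightarrow> bool" where
  "L2_infinite_dimensional M \<longleftrightarrow>
     \<not> (\<exists>B. finite B \<and> B \<subseteq> L2_fun M \<and>
          (\<forall>f\<in>L2_fun M. \<exists>c. AE x in M. f x = (\<Sum>b\<in>B. c b * b x)))"

definition L2_bounded_operator ::
    "'a measure \<Rightarrow> (('a \<Rightarrow> complex) set \<Rightarrow> ('a \<Rightarrow> complex) set) \<Rightarrow> bool" where
  "L2_bounded_operator M T \<longleftrightarrow>
     (\<forall>F\<in>L2 M. T F \<in> L2 M) \<and>
     (\<forall>F\<in>L2 M. \<forall>G\<in>L2 M. T (L2_add M F G) = L2_add M (T F) (T G)) \<and>
     (\<forall>c. \<forall>F\<in>L2 M. T (L2_scale M c F) = L2_scale M c (T F)) \<and>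
     (\<exists>C. \<forall>F\<in>L2 M. L2_norm M (T F) \<le> C * L2_norm M F)"

definition L2_dual :: "'a measure \<Rightarrow> (('a \<Rightarrow> complex) set \<Rightarrow> complex) set" where
  "L2_dual M =
     {\<Lambda>. (\<forall>F\<in>L2 M. \<forall>G\<in>L2 M. \<Lambda> (L2_add M F G) = \<Lambda> F + \<Lambda> G) \<and>
          (\<forall>c. \<forall>F\<in>L2 M. \<Lambda> (L2_scale M c F) = c * \<Lambda> F) \<and>
          (\<exists>C. \<forall>F\<in>L2 M. cmod (\<Lambda> F) \<le> C * L2_norm M F)}"

definition L2_weak_topology :: "'a measure \<Rightarrow> ('a \<Rightarrow> complex) set topology" where
  "L2_weak_topology M =
     topology_generated_by {{F \<in> L2 M. \<Lambda> F \<in> U} | \<Lambda> U. \<Lambda> \<in> L2_dual M \<and> open U}"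

definition L2_weakly_hypercyclic ::
    "'a measure \<Rightarrow> (('a \<Rightarrow> complex) set \<Rightarrow> ('a \<Rightarrow> complex) set) \<Rightarrow> bool" where
  "L2_weakly_hypercyclic M T \<longleftrightarrow>
     (\<exists>F\<in>L2 M. L2_weak_topology M closure_of (range (\<lambda>n. (T ^^ n) F)) = L2 M)"


section \<open>Weighted composition operators\<close>

definition nonsingular_map :: "'a measure \<Rightarrow> ('a \<Rightarrow> 'a) \<Rightarrow> bool" where
  "nonsingular_map M \<phi> \<longleftrightarrow> \<phi> \<in> measurable M M \<and> absolutely_continuous M (distr M M \<phi>)"

definition weighted_comp_op ::
    "'a measure \<Rightarrow> ('a \<Rightarrow> real) \<Rightarrow> ('a \<Rightarrow> 'a) \<Rightarrow> ('a \<Rightarrow> complex) set \<Rightarrow> ('a \<Rightarrow> complex) set" where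
  "weighted_comp_op M u \<phi> F = (\<Union>f\<in>F. L2_class M (\<lambda>x. complex_of_real (u x) * f (\<phi> x)))"

definition pullback_algebra :: "'a measure \<Rightarrow> ('a \<Rightarrow> 'a) \<Rightarrow> 'a measure" where
  "pullback_algebra M \<phi> = vimage_algebra (space M) \<phi> M"

definition comp_RN :: "'a measure \<Rightarrow> ('a \<Rightarrow> 'a) \<Rightarrow> 'a \<Rightarrow> ennreal" where
  "comp_RN M \<phi> = RN_deriv M (distr M M \<phi>)"

definition comp_cond_exp ::
    "'a measure \<Rightarrow> ('a \<Rightarrow> 'a) \<Rightarrow> ('a \<Rightarrow> ennreal) \<Rightarrow> 'a \<Rightarrow> ennreal" where
  "comp_cond_exp M \<phi> f = nn_cond_exp M (pullback_algebra M \<phi>) f"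

text \<open>
  \<open>E(f) \<circ> \<phi>\<^sup>-\<^sup>1\<close>: some measurable \<open>g\<close> with \<open>E(f) = g \<circ> \<phi>\<close>.  Such a \<open>g\<close> exists because \<open>E(f)\<close> is
  measurable for the pullback \<open>\<sigma>\<close>-algebra, and it is determined almost everywhere on the set
  where \<open>h\<close> does not vanish; only the product with \<open>h\<close> is used.
\<close>

definition cond_exp_comp_inv ::
    "'a measure \<Rightarrow> ('a \<Rightarrow> 'a) \<Rightarrow> ('a \<Rightarrow> ennreal) \<Rightarrow> 'a \<Rightarrow> ennreal" where
  "cond_exp_comp_inv M \<phi> f =
     (SOME g. g \<in> borel_measurable M \<and> (AE x in M. comp_cond_exp M \<phi> f x = g (\<phi> x)))"

definition weighted_J :: "'a measure \<Rightarrow> ('a \<Rightarrow> real) \<Rightarrow> ('a \<Rightarrow> 'a) \<Rightarrow> 'a \<Rightarrow> ennreal" where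
  "weighted_J M u \<phi> x =
     comp_RN M \<phi> x * cond_exp_comp_inv M \<phi> (\<lambda>y. ennreal (\<bar>u y\<bar>\<^sup>2)) x"

end

theory Submission
  imports Defs
begin

text \<open>
  Let \<open>W f = u \<cdot> (f \<circ> \<phi>)\<close>.  Since \<open>J\<close> is the density of the image of \<open>u\<^sup>2 d\<mu>\<close> under \<open>\<phi>\<close>, the norm satisfies
  \<open>\<parallel>W g\<parallel>\<^sup>2 = \<integral> J |g|\<^sup>2 d\<mu>\<close>.  The hypothesis on \<open>E(u\<^sup>2 / J)\<close> says that the image of \<open>(u\<^sup>2 / J) d\<mu>\<close> under \<open>\<phi>\<close>
  is at most \<open>\<lambda> \<mu>\<close>, hence at most \<open>\<mu>\<close>.  Applying the Cauchy--Schwarz inequality to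
  \<open>|W f|\<^sup>2 = (\<surd>J |W f|) \<cdot> (|W f| / \<surd>J)\<close> therefore gives \<open>\<parallel>W f\<parallel>\<^sup>2 \<le> \<parallel>W\<^sup>2 f\<parallel> \<parallel>f\<parallel>\<close>
  (\<open>nn_integral_weight_comp_squared_le\<close>, \<open>W_norm_log_convex\<close>).  This is the only consequence of the
  hyponormality of \<open>W\<close> that is needed, and it does not involve the adjoint.

  So the norms along every orbit form a log-convex sequence.  By \<open>log_convex_dichotomy\<close> either the
  orbit is bounded, and then it is not weakly dense (\<open>not_weakly_dense_if_bounded\<close>), or its norms grow
  geometrically.  In the second case \<open>0\<close> is not in its weak closure
  (\<open>not_weakly_dense_if_geometric_growth\<close>).  The core of the argument is the construction of a
  functional \<open>\<Sum>m. c\<^sub>m \<langle>\<cdot>, z\<^sub>m\<rangle>\<close> of modulus at least \<open>1/2\<close> at every \<open>z\<^sub>n\<close>, for nonzero vectors with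
  \<open>\<parallel>z\<^sub>n\<^sub>+\<^sub>1\<parallel> \<ge> 5 \<parallel>z\<^sub>n\<parallel>\<close>: each coefficient corrects the value at its own vector, and the growth makes the
  total effect of all later corrections at most \<open>1/2\<close>.  A slower geometric growth reduces to this one
  by splitting the orbit into finitely many subsequences.
\<close>

section \<open>Change of variables and hyponormality\<close>

text \<open>
  The Doob--Dynkin factorization: a function measurable for the \<open>\<sigma>\<close>-algebra pulled back along \<open>\<phi>\<close>
  is a measurable function of \<open>\<phi>\<close>.
\<close>

lemma factorization_through_vimage_algebra:
  fixes F :: "'a \<Rightarrow> ennreal"
  assumes "F \<in> borel_measurable (vimage_algebra X \<phi> N)" and "\<phi> \<in> X \<rightarrow> space N"
  obtains g where "g \<in> borel_measurable N" and "\<And>x. x \<in> X \<Longrightarrow> F x = g (\<phi> x)"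
proof -
  have "\<exists>g\<in>borel_measurable N. \<forall>x\<in>X. F x = g (\<phi> x)"
    using assms(1)
  proof (induction F rule: borel_measurable_induct)
    case (cong f g)
    then show ?case by (metis space_vimage_algebra)
  next
    case (set A)
    then obtain B where B: "B \<in> sets N" "A = \<phi> -` B \<inter> X"
      using assms(2) by (auto simp: sets_vimage_algebra2)
    then show ?case
      by (intro bexI[of _ "indicator B"]) (auto simp: indicator_def)
  next
    case (mult u c)
    then obtain g where "g \<in> borel_measurable N" "\<forall>x\<in>X. u x = g (\<phi> x)" by blast
    then show ?case by (intro bexI[of _ "\<lambda>x. c * g x"]) auto
  next
    case (add u v)
    then obtain g g' where "g \<in> borel_measurable N" "\<forall>x\<in>X. u x = g (\<phi> x)"
       "g' \<in> borel_measurable N" "\<forall>x\<in>X. v x = g' (\<phi> x)" by blast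
    then show ?case by (intro bexI[of _ "\<lambda>x. g' x + g x"]) auto
  next
    case (seq U)
    then obtain g where "\<And>i. g i \<in> borel_measurable N" "\<And>i x. x\<in>X \<Longrightarrow> U i x = g i (\<phi> x)"
      by metis
    then show ?case by (intro bexI[of _ "\<lambda>x. SUP i. g i x"]) (auto simp: image_image)
  qed
  then show ?thesis using that by blast
qed

text \<open>
  The measure-theoretic setting of a weighted composition operator \<open>f \<mapsto> u \<cdot> (f \<circ> \<phi>)\<close>.
\<close>

locale weighted_composition =
  fixes M :: "'a measure" and \<phi> :: "'a \<Rightarrow> 'a" and u :: "'a \<Rightarrow> real"
  assumes sigma_finite: "sigma_finite_measure M"
    and nonsingular: "nonsingular_map M \<phi>"
    and sigma_finite_pullback: "sigma_finite_subalgebra M (pullback_algebra M \<phi>)"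
    and weight_measurable [measurable]: "u \<in> borel_measurable M"
begin

lemma map_measurable [measurable]: "\<phi> \<in> measurable M M"
  using nonsingular by (simp add: nonsingular_map_def)

lemma comp_RN_measurable [measurable]: "comp_RN M \<phi> \<in> borel_measurable M"
  by (simp add: comp_RN_def)

lemma density_comp_RN: "density M (comp_RN M \<phi>) = distr M M \<phi>"
  using nonsingular unfolding comp_RN_def nonsingular_map_def
  by (intro sigma_finite_measure.density_RN_deriv[OF sigma_finite]) auto

lemma comp_cond_exp_factor:
  obtains g where "g \<in> borel_measurable M"
    and "AE x in M. comp_cond_exp M \<phi> w x = g (\<phi> x)"
proof -
  have "comp_cond_exp M \<phi> w \<in> borel_measurable (vimage_algebra (space M) \<phi> M)"
    unfolding comp_cond_exp_def pullback_algebra_def by simp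
  moreover have "\<phi> \<in> space M \<rightarrow> space M"
    using map_measurable by (auto simp: measurable_def)
  ultimately obtain g where "g \<in> borel_measurable M"
    and "\<And>x. x \<in> space M \<Longrightarrow> comp_cond_exp M \<phi> w x = g (\<phi> x)"
    by (rule factorization_through_vimage_algebra) blast
  then show ?thesis by (intro that[of g] AE_I2)
qed

text \<open>
  The change of variables behind the notation \<open>h E(w) \<circ> \<phi>\<^sup>-\<^sup>1\<close>: whenever \<open>E(w) = g \<circ> \<phi>\<close>, the function
  \<open>h g\<close> is the density of the image under \<open>\<phi>\<close> of the measure \<open>w d\<mu>\<close>.
\<close>

lemma nn_integral_cond_exp_comp_inv:
  assumes w [measurable]: "w \<in> borel_measurable M" and p [measurable]: "p \<in> borel_measurable M"
    and g [measurable]: "g \<in> borel_measurable M"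
    and Eg: "AE x in M. comp_cond_exp M \<phi> w x = g (\<phi> x)"
  shows "(\<integral>\<^sup>+x. comp_RN M \<phi> x * g x * p x \<partial>M) = (\<integral>\<^sup>+x. w x * p (\<phi> x) \<partial>M)"
proof -
  interpret sigma_finite_subalgebra M "pullback_algebra M \<phi>" by (rule sigma_finite_pullback)
  have "\<phi> \<in> space M \<rightarrow> space M" using map_measurable by (auto simp: measurable_def)
  then have [measurable]: "\<phi> \<in> measurable (pullback_algebra M \<phi>) M"
    unfolding pullback_algebra_def by (rule measurable_vimage_algebra1)
  have "(\<integral>\<^sup>+x. comp_RN M \<phi> x * g x * p x \<partial>M) = (\<integral>\<^sup>+x. g x * p x \<partial>density M (comp_RN M \<phi>))"
    by (simp add: nn_integral_density mult.assoc)
  also have "\<dots> = (\<integral>\<^sup>+x. g (\<phi> x) * p (\<phi> x) \<partial>M)"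
    by (simp add: density_comp_RN nn_integral_distr)
  also have "\<dots> = (\<integral>\<^sup>+x. p (\<phi> x) * comp_cond_exp M \<phi> w x \<partial>M)"
    by (intro nn_integral_cong_AE) (use Eg in \<open>auto simp: mult.commute\<close>)
  also have "\<dots> = (\<integral>\<^sup>+x. p (\<phi> x) * w x \<partial>M)"
    unfolding comp_cond_exp_def by (intro nn_cond_exp_intg) measurable
  finally show ?thesis by (simp add: mult.commute)
qed

lemma cond_exp_comp_inv_props:
  "cond_exp_comp_inv M \<phi> w \<in> borel_measurable M \<and>
   (AE x in M. comp_cond_exp M \<phi> w x = cond_exp_comp_inv M \<phi> w (\<phi> x))"
proof -
  have "\<exists>g. g \<in> borel_measurable M \<and> (AE x in M. comp_cond_exp M \<phi> w x = g (\<phi> x))"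
    using comp_cond_exp_factor by metis
  then show ?thesis unfolding cond_exp_comp_inv_def by (rule someI_ex)
qed

lemma weighted_J_measurable [measurable]: "weighted_J M u \<phi> \<in> borel_measurable M"
proof -
  have [measurable]: "cond_exp_comp_inv M \<phi> w \<in> borel_measurable M" for w
    using cond_exp_comp_inv_props by simp
  show ?thesis unfolding weighted_J_def[abs_def] by measurable
qed

lemma nn_integral_weighted_J:
  assumes [measurable]: "p \<in> borel_measurable M"
  shows "(\<integral>\<^sup>+x. weighted_J M u \<phi> x * p x \<partial>M) = (\<integral>\<^sup>+x. ennreal (\<bar>u x\<bar>\<^sup>2) * p (\<phi> x) \<partial>M)"
  unfolding weighted_J_def
  using cond_exp_comp_inv_props by (intro nn_integral_cond_exp_comp_inv) auto

text \<open>
  The bound \<open>(h \<circ> \<phi>) E(w) \<le> c\<close> says that the image of \<open>w d\<mu>\<close> under \<open>\<phi>\<close> is at most \<open>c \<mu>\<close>.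
\<close>

lemma nn_integral_comp_le:
  assumes w [measurable]: "w \<in> borel_measurable M" and p [measurable]: "p \<in> borel_measurable M"
    and le: "AE x in M. comp_RN M \<phi> (\<phi> x) * comp_cond_exp M \<phi> w x \<le> c"
  shows "(\<integral>\<^sup>+x. w x * p (\<phi> x) \<partial>M) \<le> c * (\<integral>\<^sup>+x. p x \<partial>M)"
proof -
  obtain g where g [measurable]: "g \<in> borel_measurable M"
    and Eg: "AE x in M. comp_cond_exp M \<phi> w x = g (\<phi> x)"
    using comp_cond_exp_factor[of w] by metis
  have "AE x in M. comp_RN M \<phi> (\<phi> x) * g (\<phi> x) \<le> c"
    using le Eg by eventually_elim simp
  then have "AE x in distr M M \<phi>. comp_RN M \<phi> x * g x \<le> c"
    by (subst AE_distr_iff) auto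
  then have "AE x in M. 0 < comp_RN M \<phi> x \<longrightarrow> comp_RN M \<phi> x * g x \<le> c"
    unfolding density_comp_RN[symmetric] by (subst (asm) AE_density) auto
  \<comment> \<open>Where \<open>h\<close> vanishes, the inequality \<open>h g \<le> c\<close> is trivial.\<close>
  then have hg: "AE x in M. comp_RN M \<phi> x * g x \<le> c"
    by eventually_elim (metis mult_zero_left not_gr_zero zero_le)
  have "(\<integral>\<^sup>+x. w x * p (\<phi> x) \<partial>M) = (\<integral>\<^sup>+x. comp_RN M \<phi> x * g x * p x \<partial>M)"
    using nn_integral_cond_exp_comp_inv[OF w p g Eg] by simp
  also have "\<dots> \<le> (\<integral>\<^sup>+x. c * p x \<partial>M)"
  proof (rule nn_integral_mono_AE)
    show "AE x in M. comp_RN M \<phi> x * g x * p x \<le> c * p x"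
      using hg by eventually_elim (simp add: mult_right_mono)
  qed
  finally show ?thesis by (simp add: nn_integral_cmult)
qed

text \<open>
  The hyponormality estimate \<open>\<parallel>W f\<parallel>\<^sup>4 \<le> c \<parallel>W\<^sup>2 f\<parallel>\<^sup>2 \<parallel>f\<parallel>\<^sup>2\<close>, written with integrals of nonnegative
  functions.  It is the Cauchy--Schwarz inequality for the factorization
  \<open>|W f|\<^sup>2 = (\<surd>J |W f|) \<cdot> (|W f| / \<surd>J)\<close>: the first factor has square integral \<open>\<parallel>W\<^sup>2 f\<parallel>\<^sup>2\<close>, and the
  square of the second one is \<open>(u\<^sup>2 / J) \<cdot> (|f|\<^sup>2 \<circ> \<phi>)\<close>.
\<close>

lemma nn_integral_weight_comp_squared_le:
  assumes supp: "AE x in M. u x \<noteq> 0 \<longrightarrow> weighted_J M u \<phi> x \<noteq> 0"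
    and le: "AE x in M. comp_RN M \<phi> (\<phi> x) * comp_cond_exp M \<phi>
             (\<lambda>y. if u y = 0 then 0 else ennreal (\<bar>u y\<bar>\<^sup>2) / weighted_J M u \<phi> y) x \<le> c"
    and [measurable]: "f \<in> borel_measurable M"
    and fin: "(\<integral>\<^sup>+x. ennreal ((u x * (u (\<phi> x) * f (\<phi> (\<phi> x))))\<^sup>2) \<partial>M) \<noteq> \<infinity>"
  shows "(\<integral>\<^sup>+x. ennreal ((u x * f (\<phi> x))\<^sup>2) \<partial>M)\<^sup>2 \<le>
     (\<integral>\<^sup>+x. ennreal ((u x * (u (\<phi> x) * f (\<phi> (\<phi> x))))\<^sup>2) \<partial>M) * (c * (\<integral>\<^sup>+x. ennreal ((f x)\<^sup>2) \<partial>M))"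
proof -
  define J where "J = weighted_J M u \<phi>"
  define j where "j x = sqrt (enn2real (J x))" for x
  define v where "v x = \<bar>u x * f (\<phi> x)\<bar>" for x
  define w where "w y = (if u y = 0 then 0 else ennreal (\<bar>u y\<bar>\<^sup>2) / J y)" for y
  have [measurable]: "J \<in> borel_measurable M" by (simp add: J_def)
  have [measurable]: "v \<in> borel_measurable M" "j \<in> borel_measurable M" "w \<in> borel_measurable M"
    unfolding v_def j_def w_def by measurable
  have Jv: "(\<integral>\<^sup>+x. J x * ennreal ((v x)\<^sup>2) \<partial>M)
      = (\<integral>\<^sup>+x. ennreal ((u x * (u (\<phi> x) * f (\<phi> (\<phi> x))))\<^sup>2) \<partial>M)"
    unfolding J_def v_def by (subst nn_integral_weighted_J)
      (auto simp: ennreal_mult' power_mult_distrib intro!: nn_integral_cong)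
  \<comment> \<open>The factorization needs \<open>0 < J < \<infinity>\<close> where \<open>v \<noteq> 0\<close>; the upper bound holds because
    \<open>J v\<^sup>2\<close> is integrable.\<close>
  have "AE x in M. J x * ennreal ((v x)\<^sup>2) \<noteq> \<infinity>"
    by (rule nn_integral_noteq_infinite) (use fin Jv in auto)
  with supp have "AE x in M. ennreal ((v x)\<^sup>2) = ennreal (j x * v x) * ennreal (v x / j x)"
  proof eventually_elim
    case (elim x)
    show ?case
    proof (cases "v x = 0")
      case False
      then have "J x \<noteq> 0" "J x \<noteq> \<infinity>"
        using elim by (auto simp: J_def v_def ennreal_mult_eq_top_iff)
      then have "0 < j x"
        by (auto simp: j_def enn2real_positive_iff less_top zero_less_iff_neq_zero)
      then show ?thesis
        by (auto simp: ennreal_mult[symmetric] v_def power2_eq_square)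
    qed simp
  qed
  then have "(\<integral>\<^sup>+x. ennreal ((u x * f (\<phi> x))\<^sup>2) \<partial>M)
      = (\<integral>\<^sup>+x. ennreal (j x * v x) * ennreal (v x / j x) \<partial>M)"
    by (intro nn_integral_cong_AE) (auto simp: v_def)
  then have "(\<integral>\<^sup>+x. ennreal ((u x * f (\<phi> x))\<^sup>2) \<partial>M)\<^sup>2
      \<le> (\<integral>\<^sup>+x. ennreal (j x * v x)^2 \<partial>M) * (\<integral>\<^sup>+x. ennreal (v x / j x)^2 \<partial>M)"
    by (simp add: Cauchy_Schwarz_nn_integral)
  also have "\<dots> \<le> (\<integral>\<^sup>+x. J x * ennreal ((v x)\<^sup>2) \<partial>M) * (\<integral>\<^sup>+x. w x * ennreal ((f (\<phi> x))\<^sup>2) \<partial>M)"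
  proof (intro mult_mono nn_integral_mono zero_le)
    fix x
    have v: "0 \<le> v x" by (simp add: v_def)
    have j: "0 \<le> j x" by (simp add: j_def)
    have "(ennreal (j x * v x))\<^sup>2 = ennreal (enn2real (J x)) * ennreal ((v x)\<^sup>2)"
      using v j by (simp add: ennreal_power ennreal_mult[symmetric] power_mult_distrib j_def)
    also have "\<dots> \<le> J x * ennreal ((v x)\<^sup>2)"
      by (intro mult_right_mono) (cases "J x"; simp)+
    finally show "(ennreal (j x * v x))\<^sup>2 \<le> J x * ennreal ((v x)\<^sup>2)" .
    show "(ennreal (v x / j x))\<^sup>2 \<le> w x * ennreal ((f (\<phi> x))\<^sup>2)"
    proof (cases "J x")
      case (real r)
      show ?thesis
      proof (cases "u x = 0 \<or> r = 0")
        case True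
        then show ?thesis using real by (auto simp: v_def j_def)
      next
        case False
        then have "0 < r" using real by simp
        then have "w x = ennreal ((u x)\<^sup>2 / r)"
          using False real by (simp add: w_def divide_ennreal)
        moreover have "(ennreal (v x / j x))\<^sup>2 = ennreal ((v x)\<^sup>2 / r)"
          using v j real by (simp add: ennreal_power power_divide j_def)
        ultimately show ?thesis using \<open>0 < r\<close>
          by (simp add: ennreal_mult[symmetric] v_def power_mult_distrib)
      qed
    qed (simp add: j_def)
  qed
  also have "\<dots> \<le> (\<integral>\<^sup>+x. J x * ennreal ((v x)\<^sup>2) \<partial>M) * (c * (\<integral>\<^sup>+x. ennreal ((f x)\<^sup>2) \<partial>M))"
    using le unfolding J_def[symmetric] w_def[abs_def, symmetric]
    by (intro mult_left_mono nn_integral_comp_le zero_le) simp_all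
  finally show ?thesis unfolding Jv .
qed

end

section \<open>Coefficients of a separating functional\<close>

text \<open>
  Coefficients for a functional bounded below on a sequence of vectors \<open>z\<^sub>n\<close>, where \<open>A m n\<close> stands for
  \<open>\<langle>z\<^sub>n, z\<^sub>m\<rangle>\<close> and \<open>N n\<close> for \<open>\<parallel>z\<^sub>n\<parallel>\<close>.  The functional is \<open>f \<mapsto> \<Sum>m. c\<^sub>m \<langle>f, z\<^sub>m\<rangle>\<close>.  The coefficient \<open>c\<^sub>n\<close> is
  \<open>0\<close> if the earlier terms already have a sum of modulus at least \<open>1\<close> at \<open>z\<^sub>n\<close>; otherwise it is chosen
  such that the \<open>n\<close>-th term takes the value \<open>2\<close> at \<open>z\<^sub>n\<close>.
\<close>

fun separating_coeff :: "(nat \<Rightarrow> nat \<Rightarrow> complex) \<Rightarrow> (nat \<Rightarrow> real) \<Rightarrow> nat \<Rightarrow> real" where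
  "separating_coeff A N n =
     (if 1 \<le> cmod (\<Sum>m<n. of_real (separating_coeff A N m) * A m n) then 0 else 2 / (N n)\<^sup>2)"

declare separating_coeff.simps [simp del]

lemma separating_coeff_bounds: "0 \<le> separating_coeff A N n" "separating_coeff A N n \<le> 2 / (N n)\<^sup>2"
  by (subst separating_coeff.simps; simp)+

lemma separating_coeff_partial_sum:
  assumes "A n n = of_real ((N n)\<^sup>2)" "0 < N n"
  shows "1 \<le> cmod (\<Sum>m<Suc n. of_real (separating_coeff A N m) * A m n)"
proof (cases "1 \<le> cmod (\<Sum>m<n. of_real (separating_coeff A N m) * A m n)")
  case True
  then have "separating_coeff A N n = 0" by (subst separating_coeff.simps) simp
  with True show ?thesis by simp
next
  case False
  then have "separating_coeff A N n = 2 / (N n)\<^sup>2" by (subst separating_coeff.simps) simp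
  then have "of_real (separating_coeff A N n) * A n n = 2"
    using assms by simp
  then have "cmod 2 - cmod (\<Sum>m<n. of_real (separating_coeff A N m) * A m n)
      \<le> cmod (\<Sum>m<Suc n. of_real (separating_coeff A N m) * A m n)"
    using norm_diff_ineq[of 2 "\<Sum>m<n. of_real (separating_coeff A N m) * A m n"]
    by (simp add: add.commute)
  with False show ?thesis by simp
qed

lemma geometric_lower_bound:
  fixes a :: "nat \<Rightarrow> real"
  assumes "0 \<le> r" "\<And>n. r * a n \<le> a (Suc n)"
  shows "r ^ k * a n \<le> a (n + k)"
proof (induction k)
  case (Suc k)
  have "r ^ Suc k * a n \<le> r * a (n + k)"
    using mult_left_mono[OF Suc \<open>0 \<le> r\<close>] by (simp add: mult.assoc)
  also have "\<dots> \<le> a (n + Suc k)" using assms(2)[of "n + k"] by simp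
  finally show ?case .
qed simp

text \<open>
  If the norms grow by the factor \<open>5\<close>, then the terms after the \<open>n\<close>-th contribute at \<open>z\<^sub>n\<close> at most
  \<open>2 (1/5 + 1/25 + \<dots>) = 1/2\<close>, so they cannot destroy the lower bound \<open>1\<close> of the partial sum.
\<close>

lemma separating_coeff_series:
  assumes diag: "\<And>n. A n n = of_real ((N n)\<^sup>2)" and pos: "\<And>n. 0 < N n"
    and growth: "\<And>n. 5 * N n \<le> N (Suc n)"
    and CS: "\<And>m n. cmod (A m n) \<le> N m * N n"
  shows "1 / 2 \<le> cmod (\<Sum>m. of_real (separating_coeff A N m) * A m n)"
proof -
  define t where "t m = of_real (separating_coeff A N m) * A m n" for m
  have bound: "cmod (t (k + Suc n)) \<le> 2 / 5 * (1 / 5) ^ k" for k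
  proof -
    let ?m = "k + Suc n"
    have "5 ^ Suc k * N n \<le> N (n + Suc k)"
      by (rule geometric_lower_bound) (use growth in auto)
    then have Nm: "5 ^ Suc k * N n \<le> N ?m" by (simp add: add.commute)
    have "cmod (t ?m) = separating_coeff A N ?m * cmod (A ?m n)"
      using separating_coeff_bounds(1) by (simp add: t_def norm_mult)
    also have "\<dots> \<le> 2 / (N ?m)\<^sup>2 * (N ?m * N n)"
      using separating_coeff_bounds CS by (intro mult_mono) auto
    also have "\<dots> = 2 * N n / N ?m"
      using pos[of ?m] by (simp add: power2_eq_square)
    also have "\<dots> \<le> 2 * N n / (5 ^ Suc k * N n)"
      using Nm pos[of n] pos[of ?m] by (intro divide_left_mono) auto
    also have "\<dots> = 2 / 5 * (1 / 5) ^ k"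
      using pos[of n] by (simp add: power_divide)
    finally show ?thesis .
  qed
  have geo: "(\<lambda>k. 2 / 5 * (1 / 5) ^ k) sums (2 / 5 * (1 / (1 - 1 / 5)) :: real)"
    by (intro sums_mult geometric_sums) simp
  have sm: "summable (\<lambda>k. cmod (t (k + Suc n)))"
    by (rule summable_comparison_test'[OF sums_summable[OF geo]]) (use bound in auto)
  then have sm': "summable t"
    by (metis summable_iff_shift summable_norm_cancel)
  have "cmod (\<Sum>k. t (k + Suc n)) \<le> (\<Sum>k. cmod (t (k + Suc n)))"
    using sm by (rule summable_norm)
  also have "\<dots> \<le> (\<Sum>k. 2 / 5 * (1 / 5) ^ k)"
    using bound sm sums_summable[OF geo] by (rule suminf_le)
  also have "\<dots> = 1 / 2" using sums_unique[OF geo] by simp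
  finally have tail: "cmod (\<Sum>k. t (k + Suc n)) \<le> 1 / 2" .
  have "1 \<le> cmod (\<Sum>m<Suc n. t m)"
    unfolding t_def using diag pos by (rule separating_coeff_partial_sum)
  also have "\<dots> \<le> cmod (suminf t) + cmod (\<Sum>k. t (k + Suc n))"
    unfolding suminf_split_initial_segment[OF sm', of "Suc n"]
    by (metis add.commute add_diff_cancel_left' norm_triangle_ineq4)
  finally have "1 / 2 \<le> cmod (suminf t)" using tail by linarith
  then show ?thesis by (simp add: t_def[abs_def])
qed

section \<open>Square-integrable functions and their classes\<close>

text \<open>
  The \<open>L\<^sup>2\<close> norm of a function, as opposed to that of its class modulo equality almost everywhere.
\<close>

definition L2_fun_norm :: "'a measure \<Rightarrow> ('a \<Rightarrow> complex) \<Rightarrow> real" where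
  "L2_fun_norm M f = sqrt (\<integral>x. (cmod (f x))\<^sup>2 \<partial>M)"

text \<open>
  The inner product of two functions, linear in the first one.
\<close>

definition L2_inner :: "'a measure \<Rightarrow> ('a \<Rightarrow> complex) \<Rightarrow> ('a \<Rightarrow> complex) \<Rightarrow> complex" where
  "L2_inner M f g = (\<integral>x. f x * cnj (g x) \<partial>M)"

lemma L2_funD:
  assumes "f \<in> L2_fun M"
  shows "f \<in> borel_measurable M" "integrable M (\<lambda>x. (cmod (f x))\<^sup>2)"
  using assms by (auto simp: L2_fun_def)

lemma L2_fun_norm_nonneg: "0 \<le> L2_fun_norm M f"
  by (simp add: L2_fun_norm_def)

lemma nn_integral_L2_fun:
  assumes "f \<in> L2_fun M"
  shows "(\<integral>\<^sup>+x. ennreal ((cmod (f x))\<^sup>2) \<partial>M) = ennreal ((L2_fun_norm M f)\<^sup>2)"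
  using L2_funD[OF assms] by (subst nn_integral_eq_integral) (auto simp: L2_fun_norm_def)

lemma L2_fun_add:
  assumes "f \<in> L2_fun M" "g \<in> L2_fun M"
  shows "(\<lambda>x. f x + g x) \<in> L2_fun M"
proof -
  note [measurable] = L2_funD(1)[OF assms(1)] L2_funD(1)[OF assms(2)]
  have le: "(cmod (a + b))\<^sup>2 \<le> 2 * (cmod a)\<^sup>2 + 2 * (cmod b)\<^sup>2" for a b :: complex
  proof -
    have "(cmod (a + b))\<^sup>2 \<le> (cmod a + cmod b)\<^sup>2"
      by (intro power_mono norm_triangle_ineq) simp
    also have "\<dots> \<le> 2 * (cmod a)\<^sup>2 + 2 * (cmod b)\<^sup>2"
      using zero_le_power2[of "cmod a - cmod b"] by (simp add: power2_eq_square algebra_simps)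
    finally show ?thesis .
  qed
  have "integrable M (\<lambda>x. (cmod (f x + g x))\<^sup>2)"
  proof (rule Bochner_Integration.integrable_bound)
    show "integrable M (\<lambda>x. 2 * (cmod (f x))\<^sup>2 + 2 * (cmod (g x))\<^sup>2)"
      using assms by (auto simp: L2_fun_def)
    show "AE x in M. norm ((cmod (f x + g x))\<^sup>2) \<le> norm (2 * (cmod (f x))\<^sup>2 + 2 * (cmod (g x))\<^sup>2)"
      using le by auto
  qed measurable
  then show ?thesis by (auto simp: L2_fun_def)
qed

lemma L2_fun_scale: "f \<in> L2_fun M \<Longrightarrow> (\<lambda>x. c * f x) \<in> L2_fun M"
  by (auto simp: L2_fun_def norm_mult power_mult_distrib)

lemma L2_inner_integrable:
  assumes "f \<in> L2_fun M" "g \<in> L2_fun M"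
  shows "integrable M (\<lambda>x. f x * cnj (g x))"
proof (rule Bochner_Integration.integrable_bound)
  note [measurable] = L2_funD(1)[OF assms(1)] L2_funD(1)[OF assms(2)]
  show "integrable M (\<lambda>x. (cmod (f x))\<^sup>2 + (cmod (g x))\<^sup>2)"
    using assms by (auto simp: L2_fun_def)
  have [measurable]: "(\<lambda>x. cnj (g x)) \<in> borel_measurable M"
    by (rule borel_measurable_continuous_on[of cnj]) (auto intro: continuous_intros)
  show "(\<lambda>x. f x * cnj (g x)) \<in> borel_measurable M" by measurable
  have "a * b \<le> a\<^sup>2 + b\<^sup>2" if "0 \<le> a" "0 \<le> b" for a b :: real
    using sum_squares_bound[of a b] mult_nonneg_nonneg[OF that] by linarith
  then show "AE x in M. norm (f x * cnj (g x)) \<le> norm ((cmod (f x))\<^sup>2 + (cmod (g x))\<^sup>2)"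
    by (auto simp: norm_mult)
qed

lemma L2_inner_self:
  assumes "f \<in> L2_fun M"
  shows "L2_inner M f f = of_real ((L2_fun_norm M f)\<^sup>2)"
  by (simp add: L2_inner_def L2_fun_norm_def complex_mult_cnj cmod_power2[symmetric] of_real_power[symmetric] del: of_real_power)

lemma L2_inner_CS:
  assumes "f \<in> L2_fun M" "g \<in> L2_fun M"
  shows "cmod (L2_inner M f g) \<le> L2_fun_norm M f * L2_fun_norm M g"
proof -
  note [measurable] = L2_funD(1)[OF assms(1)] L2_funD(1)[OF assms(2)]
  have int: "integrable M (\<lambda>x. cmod (f x) * cmod (g x))"
    using integrable_norm[OF L2_inner_integrable[OF assms]] by (simp add: norm_mult)
  define I where "I = (\<integral>x. cmod (f x) * cmod (g x) \<partial>M)"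
  have "(\<integral>\<^sup>+x. ennreal (cmod (f x)) * ennreal (cmod (g x)) \<partial>M)\<^sup>2
      \<le> (\<integral>\<^sup>+x. (ennreal (cmod (f x)))\<^sup>2 \<partial>M) * (\<integral>\<^sup>+x. (ennreal (cmod (g x)))\<^sup>2 \<partial>M)"
    by (rule Cauchy_Schwarz_nn_integral) measurable
  also have "(\<integral>\<^sup>+x. ennreal (cmod (f x)) * ennreal (cmod (g x)) \<partial>M) = ennreal I"
    using int by (simp add: I_def ennreal_mult[symmetric] nn_integral_eq_integral)
  finally have "ennreal (I\<^sup>2) \<le> ennreal ((L2_fun_norm M f)\<^sup>2 * (L2_fun_norm M g)\<^sup>2)"
    using assms by (simp add: ennreal_power nn_integral_L2_fun ennreal_mult[symmetric] I_def)
  then have "I\<^sup>2 \<le> (L2_fun_norm M f * L2_fun_norm M g)\<^sup>2"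
    by (simp add: power_mult_distrib)
  then have "I \<le> L2_fun_norm M f * L2_fun_norm M g"
    by (rule power2_le_imp_le) (simp add: L2_fun_norm_nonneg)
  moreover have "cmod (L2_inner M f g) \<le> I"
    unfolding L2_inner_def I_def
    by (metis (no_types, lifting) Bochner_Integration.integral_cong complex_mod_cnj integral_norm_bound norm_mult)
  ultimately show ?thesis by simp
qed

lemma L2_fun_norm_cong:
  assumes "AE x in M. f x = g x" "f \<in> L2_fun M" "g \<in> L2_fun M"
  shows "L2_fun_norm M f = L2_fun_norm M g"
proof -
  note [measurable] = L2_funD(1)[OF assms(2)] L2_funD(1)[OF assms(3)]
  have "(\<integral>x. (cmod (f x))\<^sup>2 \<partial>M) = (\<integral>x. (cmod (g x))\<^sup>2 \<partial>M)"
    by (rule integral_cong_AE) (use assms(1) in auto)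
  then show ?thesis by (simp add: L2_fun_norm_def)
qed

lemma equiv_L2_rel: "equiv (L2_fun M) (L2_rel M)"
proof (rule equivI)
  show "refl_on (L2_fun M) (L2_rel M)" by (auto simp: refl_on_def L2_rel_def)
  show "sym (L2_rel M)" by (auto simp: sym_def L2_rel_def)
  show "trans (L2_rel M)"
  proof (rule transI)
    fix f g h assume "(f, g) \<in> L2_rel M" "(g, h) \<in> L2_rel M"
    then have "f \<in> L2_fun M" "h \<in> L2_fun M"
      "AE x in M. f x = g x" "AE x in M. g x = h x" by (auto simp: L2_rel_def)
    moreover from this(3,4) have "AE x in M. f x = h x" by eventually_elim simp
    ultimately show "(f, h) \<in> L2_rel M" by (simp add: L2_rel_def)
  qed
qed (auto simp: L2_rel_def)

lemma mem_L2_class: "g \<in> L2_class M f \<longleftrightarrow> f \<in> L2_fun M \<and> g \<in> L2_fun M \<and> (AE x in M. f x = g x)"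
  by (auto simp: L2_class_def L2_rel_def)

lemma L2_class_self: "f \<in> L2_fun M \<Longrightarrow> f \<in> L2_class M f"
  by (simp add: mem_L2_class)

lemma L2_class_eq: "g \<in> L2_class M f \<Longrightarrow> L2_class M g = L2_class M f"
  unfolding L2_class_def using equiv_class_eq[OF equiv_L2_rel] by fastforce

lemma L2_class_in_L2: "f \<in> L2_fun M \<Longrightarrow> L2_class M f \<in> L2 M"
  by (simp add: L2_class_def L2_def quotientI)

lemma L2_cases:
  assumes "F \<in> L2 M"
  obtains f where "f \<in> L2_fun M" "F = L2_class M f"
  using assms by (auto simp: L2_def L2_class_def elim: quotientE)

lemma L2_norm_class:
  assumes "f \<in> L2_fun M"
  shows "L2_norm M (L2_class M f) = L2_fun_norm M f"
proof -
  have "L2_fun_norm M g = L2_fun_norm M f" if "g \<in> L2_class M f" for g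
    using that by (auto simp: mem_L2_class intro: L2_fun_norm_cong[symmetric])
  then have "(\<lambda>f. sqrt (\<integral>x. (cmod (f x))\<^sup>2 \<partial>M)) ` L2_class M f = {L2_fun_norm M f}"
    using L2_class_self[OF assms] unfolding L2_fun_norm_def[symmetric] by blast
  then show ?thesis by (simp add: L2_norm_def)
qed

lemma L2_add_class:
  assumes "f \<in> L2_fun M" "g \<in> L2_fun M"
  shows "L2_add M (L2_class M f) (L2_class M g) = L2_class M (\<lambda>x. f x + g x)"
proof -
  have "L2_class M (\<lambda>x. f' x + g' x) = L2_class M (\<lambda>x. f x + g x)"
    if "f' \<in> L2_class M f" "g' \<in> L2_class M g" for f' g'
  proof (rule L2_class_eq)
    have "AE x in M. f x = f' x" "AE x in M. g x = g' x"
      using that by (auto simp: mem_L2_class)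
    then have "AE x in M. f x + g x = f' x + g' x" by eventually_elim simp
    then show "(\<lambda>x. f' x + g' x) \<in> L2_class M (\<lambda>x. f x + g x)"
      using that by (simp add: mem_L2_class L2_fun_add)
  qed
  then show ?thesis
    unfolding L2_add_def using L2_class_self[OF assms(1)] L2_class_self[OF assms(2)] by blast
qed

lemma L2_scale_class:
  assumes "f \<in> L2_fun M"
  shows "L2_scale M c (L2_class M f) = L2_class M (\<lambda>x. c * f x)"
proof -
  have "L2_class M (\<lambda>x. c * f' x) = L2_class M (\<lambda>x. c * f x)" if "f' \<in> L2_class M f" for f'
  proof (rule L2_class_eq)
    have "AE x in M. f x = f' x"
      using that by (auto simp: mem_L2_class)
    then have "AE x in M. c * f x = c * f' x" by eventually_elim simp
    then show "(\<lambda>x. c * f' x) \<in> L2_class M (\<lambda>x. c * f x)"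
      using that by (simp add: mem_L2_class L2_fun_scale)
  qed
  then show ?thesis
    unfolding L2_scale_def using L2_class_self[OF assms(1)] by blast
qed

section \<open>Functionals and weak closure\<close>

text \<open>
  Bounded linear functionals on square-integrable functions.  Boundedness forces such a functional to
  respect equality almost everywhere, so that it descends to the space of classes.
\<close>

definition L2_functional :: "'a measure \<Rightarrow> (('a \<Rightarrow> complex) \<Rightarrow> complex) \<Rightarrow> bool" where
  "L2_functional M \<Lambda> \<longleftrightarrow>
     (\<forall>f\<in>L2_fun M. \<forall>g\<in>L2_fun M. \<Lambda> (\<lambda>x. f x + g x) = \<Lambda> f + \<Lambda> g) \<and>
     (\<forall>c. \<forall>f\<in>L2_fun M. \<Lambda> (\<lambda>x. c * f x) = c * \<Lambda> f) \<and>
     (\<exists>C. \<forall>f\<in>L2_fun M. cmod (\<Lambda> f) \<le> C * L2_fun_norm M f)"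

text \<open>
  The induced functional on classes, evaluated at an arbitrary representative.
\<close>

definition L2_lift :: "(('a \<Rightarrow> complex) \<Rightarrow> complex) \<Rightarrow> ('a \<Rightarrow> complex) set \<Rightarrow> complex" where
  "L2_lift \<Lambda> F = \<Lambda> (SOME f. f \<in> F)"

lemma L2_functional_cong:
  assumes "L2_functional M \<Lambda>" "g \<in> L2_class M f"
  shows "\<Lambda> g = \<Lambda> f"
proof -
  have f: "f \<in> L2_fun M" and g: "g \<in> L2_fun M" and ae: "AE x in M. f x = g x"
    using assms(2) by (auto simp: mem_L2_class)
  define d where "d x = g x + (- 1) * f x" for x
  have d: "d \<in> L2_fun M"
    unfolding d_def by (intro L2_fun_add L2_fun_scale f g)
  have z: "(\<lambda>x. 0) \<in> L2_fun M" by (simp add: L2_fun_def)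
  have "AE x in M. d x = 0" using ae by eventually_elim (simp add: d_def)
  from L2_fun_norm_cong[OF this d z] have "L2_fun_norm M d = 0"
    by (simp add: L2_fun_norm_def)
  moreover obtain C where "\<forall>f\<in>L2_fun M. cmod (\<Lambda> f) \<le> C * L2_fun_norm M f"
    using assms(1) by (auto simp: L2_functional_def)
  ultimately have "\<Lambda> d = 0" using d by fastforce
  moreover have "\<Lambda> d = \<Lambda> g + (- 1) * \<Lambda> f"
    using assms(1) f g L2_fun_scale[OF f, of "- 1"] unfolding L2_functional_def d_def[abs_def] by metis
  ultimately show ?thesis by simp
qed

lemma L2_lift_class:
  assumes "L2_functional M \<Lambda>" "f \<in> L2_fun M"
  shows "L2_lift \<Lambda> (L2_class M f) = \<Lambda> f"
  unfolding L2_lift_def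
  by (rule L2_functional_cong[OF assms(1) someI[of "\<lambda>g. g \<in> L2_class M f", OF L2_class_self[OF assms(2)]]])

lemma L2_lift_in_dual:
  assumes "L2_functional M \<Lambda>"
  shows "L2_lift \<Lambda> \<in> L2_dual M"
proof -
  note lift = L2_lift_class[OF assms]
  obtain C where C: "\<forall>f\<in>L2_fun M. cmod (\<Lambda> f) \<le> C * L2_fun_norm M f"
    using assms by (auto simp: L2_functional_def)
  have "L2_lift \<Lambda> (L2_add M F G) = L2_lift \<Lambda> F + L2_lift \<Lambda> G"
    if FG: "F \<in> L2 M" "G \<in> L2 M" for F G
  proof -
    obtain f g where "f \<in> L2_fun M" "F = L2_class M f" "g \<in> L2_fun M" "G = L2_class M g"
      using FG L2_cases by metis
    then show ?thesis
      using assms by (simp add: L2_add_class lift L2_fun_add) (simp add: L2_functional_def)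
  qed
  moreover have "L2_lift \<Lambda> (L2_scale M c F) = c * L2_lift \<Lambda> F" "cmod (L2_lift \<Lambda> F) \<le> C * L2_norm M F"
    if F: "F \<in> L2 M" for c F
  proof -
    obtain f where f: "f \<in> L2_fun M" "F = L2_class M f"
      using F L2_cases by metis
    then show "L2_lift \<Lambda> (L2_scale M c F) = c * L2_lift \<Lambda> F"
      using assms by (simp add: L2_scale_class lift L2_fun_scale) (simp add: L2_functional_def)
    show "cmod (L2_lift \<Lambda> F) \<le> C * L2_norm M F"
      using f C by (simp add: lift L2_norm_class)
  qed
  ultimately show ?thesis unfolding L2_dual_def by blast
qed

lemma L2_inner_add:
  assumes "f \<in> L2_fun M" "f' \<in> L2_fun M" "g \<in> L2_fun M"
  shows "L2_inner M (\<lambda>x. f x + f' x) g = L2_inner M f g + L2_inner M f' g"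
  using L2_inner_integrable[OF assms(1,3)] L2_inner_integrable[OF assms(2,3)]
  by (simp add: L2_inner_def distrib_right)

lemma L2_inner_scale: "L2_inner M (\<lambda>x. c * f x) g = c * L2_inner M f g"
  by (simp add: L2_inner_def mult.assoc)

lemma L2_functional_inner:
  assumes g: "g \<in> L2_fun M"
  shows "L2_functional M (\<lambda>f. L2_inner M f g)"
proof -
  have "\<forall>f\<in>L2_fun M. cmod (L2_inner M f g) \<le> L2_fun_norm M g * L2_fun_norm M f"
    using L2_inner_CS[OF _ g] by (simp add: mult.commute)
  then show ?thesis
    unfolding L2_functional_def using L2_inner_add[OF _ _ g] L2_inner_scale by blast
qed

text \<open>
  Defining the functional by its series, instead of by a vector that represents it, makes the
  completeness of \<open>L\<^sup>2(\<mu>)\<close> unnecessary.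
\<close>

lemma L2_functional_series:
  fixes c :: "nat \<Rightarrow> real"
  assumes g: "\<And>m. g m \<in> L2_fun M" and c: "\<And>m. 0 \<le> c m"
    and sm: "summable (\<lambda>m. c m * L2_fun_norm M (g m))"
  shows "L2_functional M (\<lambda>f. \<Sum>m. of_real (c m) * L2_inner M f (g m))"
proof -
  define t where "t f m = of_real (c m) * L2_inner M f (g m)" for f m
  define C where "C = (\<Sum>m. c m * L2_fun_norm M (g m))"
  have le: "cmod (t f m) \<le> c m * L2_fun_norm M (g m) * L2_fun_norm M f" if "f \<in> L2_fun M" for f m
    using mult_left_mono[OF L2_inner_CS[OF that g[of m]] c[of m]] c
    by (simp add: t_def norm_mult ac_simps)
  have abs: "summable (\<lambda>m. cmod (t f m))" if "f \<in> L2_fun M" for f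
    by (rule summable_comparison_test'[OF summable_mult2[OF sm, of "L2_fun_norm M f"]])
      (use le[OF that] in auto)
  note conv = summable_norm_cancel[OF abs]
  have "suminf (t (\<lambda>x. f x + f' x)) = suminf (t f) + suminf (t f')"
    if "f \<in> L2_fun M" "f' \<in> L2_fun M" for f f'
    using suminf_add[OF conv[OF that(1)] conv[OF that(2)]] that
    by (simp add: t_def[abs_def] L2_inner_add g distrib_left)
  moreover have "suminf (t (\<lambda>x. a * f x)) = a * suminf (t f)" if "f \<in> L2_fun M" for a f
    using suminf_mult[OF conv[OF that], of a]
    by (simp add: t_def[abs_def] L2_inner_scale mult.left_commute)
  moreover have "cmod (suminf (t f)) \<le> C * L2_fun_norm M f" if "f \<in> L2_fun M" for f
  proof -
    have "cmod (suminf (t f)) \<le> (\<Sum>m. cmod (t f m))"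
      using abs[OF that] by (rule summable_norm)
    also have "\<dots> \<le> (\<Sum>m. c m * L2_fun_norm M (g m) * L2_fun_norm M f)"
      using le[OF that] abs[OF that] summable_mult2[OF sm] by (rule suminf_le)
    also have "\<dots> = C * L2_fun_norm M f" by (simp add: C_def suminf_mult2[OF sm])
    finally show ?thesis .
  qed
  ultimately show ?thesis unfolding L2_functional_def t_def by blast
qed

text \<open>
  A point of the weak closure can be approximated for finitely many functionals simultaneously.
\<close>

lemma weak_closure_approx:
  assumes G: "G \<in> L2_weak_topology M closure_of S" "G \<in> L2 M"
    and I: "finite I" "I \<noteq> {}"
    and L: "\<And>i. i \<in> I \<Longrightarrow> L i \<in> L2_dual M" "\<And>i. i \<in> I \<Longrightarrow> open (U i)" "\<And>i. i \<in> I \<Longrightarrow> L i G \<in> U i"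
  shows "\<exists>F\<in>S. \<forall>i\<in>I. L i F \<in> U i"
proof -
  have "openin (L2_weak_topology M) (\<Inter>i\<in>I. {F \<in> L2 M. L i F \<in> U i})"
  proof (rule openin_Inter)
    fix A assume "A \<in> (\<lambda>i. {F \<in> L2 M. L i F \<in> U i}) ` I"
    then show "openin (L2_weak_topology M) A"
      unfolding L2_weak_topology_def using L by (intro topology_generated_by_Basis) auto
  qed (use I in auto)
  moreover have "G \<in> (\<Inter>i\<in>I. {F \<in> L2 M. L i F \<in> U i})" using G(2) L(3) by auto
  ultimately obtain F where "F \<in> S" "F \<in> (\<Inter>i\<in>I. {F \<in> L2 M. L i F \<in> U i})"
    using G(1) by (auto simp only: in_closure_of)
  then show ?thesis by auto
qed

lemma L2_nontrivial:
  assumes "L2_infinite_dimensional M"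
  obtains f where "f \<in> L2_fun M" "0 < L2_fun_norm M f"
proof -
  have "\<exists>f\<in>L2_fun M. \<not> (AE x in M. f x = 0)"
  proof (rule ccontr)
    assume "\<not> ?thesis"
    then have "finite ({} :: ('a \<Rightarrow> complex) set) \<and> {} \<subseteq> L2_fun M \<and>
        (\<forall>f\<in>L2_fun M. \<exists>c. AE x in M. f x = (\<Sum>b\<in>{}. c b * b x))"
      by simp
    then show False using assms unfolding L2_infinite_dimensional_def by blast
  qed
  then obtain f where f: "f \<in> L2_fun M" "\<not> (AE x in M. f x = 0)" by blast
  have "L2_fun_norm M f \<noteq> 0"
    using f L2_funD[OF f(1)] by (auto simp: L2_fun_norm_def integral_nonneg_eq_0_iff_AE)
  then show ?thesis using that f L2_fun_norm_nonneg[of M f] by force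
qed

text \<open>
  A sequence whose norms grow by the factor \<open>5\<close> is kept away from \<open>0\<close> by a single functional.
\<close>

lemma L2_functional_bounded_below:
  assumes z: "\<And>k. z k \<in> L2_fun M" and pos: "\<And>k. 0 < L2_fun_norm M (z k)"
    and growth: "\<And>k. 5 * L2_fun_norm M (z k) \<le> L2_fun_norm M (z (Suc k))"
  shows "\<exists>\<Lambda>. L2_functional M \<Lambda> \<and> (\<forall>k. 1 / 2 \<le> cmod (\<Lambda> (z k)))"
proof -
  define N where "N k = L2_fun_norm M (z k)" for k
  define A where "A m n = L2_inner M (z n) (z m)" for m n
  define c where "c = separating_coeff A N"
  have N: "0 < N k" "5 * N k \<le> N (Suc k)" for k
    using pos growth by (auto simp: N_def)
  have "summable (\<lambda>m. c m * N m)"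
  proof (rule summable_comparison_test')
    show "summable (\<lambda>m. 2 / N 0 * (1 / 5) ^ m)"
      by (intro summable_mult summable_geometric) simp
    fix m :: nat
    have "5 ^ m * N 0 \<le> N m"
      using geometric_lower_bound[of 5 N m 0] N(2) by simp
    have "c m * N m \<le> 2 / (N m)\<^sup>2 * N m"
      unfolding c_def using N(1)[of m] by (intro mult_right_mono separating_coeff_bounds) simp
    also have "\<dots> = 2 / N m" using N(1)[of m] by (simp add: power2_eq_square)
    also have "\<dots> \<le> 2 / (5 ^ m * N 0)"
      using \<open>5 ^ m * N 0 \<le> N m\<close> N(1)[of 0] N(1)[of m] by (intro divide_left_mono) auto
    finally show "norm (c m * N m) \<le> 2 / N 0 * (1 / 5) ^ m"
      using N(1)[of m] separating_coeff_bounds(1)[of A N m]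
      by (simp add: c_def power_divide mult.commute)
  qed
  then have "L2_functional M (\<lambda>f. \<Sum>m. of_real (c m) * L2_inner M f (z m))"
    using z unfolding N_def by (intro L2_functional_series) (auto simp: c_def separating_coeff_bounds)
  moreover have "1 / 2 \<le> cmod (\<Sum>m. of_real (c m) * A m n)" for n
    unfolding c_def
  proof (rule separating_coeff_series)
    show "A n n = of_real ((N n)\<^sup>2)" for n
      by (simp add: A_def N_def L2_inner_self z)
    show "cmod (A m n) \<le> N m * N n" for m n
      using L2_inner_CS[OF z[of n] z[of m]] by (simp add: A_def N_def mult.commute)
  qed (use N in auto)
  ultimately show ?thesis unfolding A_def by blast
qed

section \<open>Sequences that are not weakly dense\<close>

text \<open>
  For a log-convex sequence the quotients of consecutive terms do not decrease.  Either none exceeds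
  \<open>1\<close>, or from some index on they are at least some \<open>r > 1\<close>.
\<close>

lemma log_convex_dichotomy:
  fixes a :: "nat \<Rightarrow> real"
  assumes nonneg: "\<And>n. 0 \<le> a n" and convex: "\<And>n. (a (Suc n))\<^sup>2 \<le> a (Suc (Suc n)) * a n"
  obtains (bounded) "\<And>n. a n \<le> a 0"
  | (growth) r n0 where "1 < r" "\<And>n. n0 \<le> n \<Longrightarrow> r * a n \<le> a (Suc n)" "\<And>n. 0 < a n"
proof (cases "\<forall>n. a (Suc n) \<le> a n")
  case True
  then have "a n \<le> a 0" for n by (induction n) (auto intro: order_trans)
  then show ?thesis using bounded by blast
next
  case False
  then obtain n0 where n0: "a n0 < a (Suc n0)" by (auto simp: not_le)
  have zero: "a (n + k) = 0" if "0 < k" "a n = 0" for n k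
    using that(1)
  proof (induction k rule: nat_induct_non_zero)
    case 1 then show ?case using convex[of n] that(2) by simp
  next
    case (Suc k) then show ?case using convex[of "n + k"] by simp
  qed
  \<comment> \<open>A log-convex sequence that reaches \<open>0\<close> stays there, so no term before the increase vanishes.\<close>
  have pos: "0 < a n" if "n \<le> n0" for n
  proof (rule ccontr)
    assume "\<not> 0 < a n"
    then have "a n = 0" using nonneg[of n] by simp
    from zero[of "Suc n0 - n", OF _ this] that have "a (Suc n0) = 0" by simp
    then show False using n0 nonneg[of n0] by simp
  qed
  define r where "r = a (Suc n0) / a n0"
  have r: "1 < r" using n0 pos[of n0] by (simp add: r_def)
  have step: "r * a (n0 + k) \<le> a (Suc (n0 + k)) \<and> 0 < a (n0 + k)" for k
  proof (induction k)
    case 0 then show ?case using pos[of n0] by (simp add: r_def)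
  next
    case (Suc k)
    let ?b = "a (n0 + k)" and ?c = "a (Suc (n0 + k))"
    have c: "0 < ?c" using Suc r by (smt (verit) mult_pos_pos)
    have "r * ?b * ?c \<le> ?c\<^sup>2"
      using Suc c by (simp add: power2_eq_square)
    also have "\<dots> \<le> a (Suc (Suc (n0 + k))) * ?b" by (rule convex)
    finally have "?b * (r * ?c) \<le> ?b * a (Suc (Suc (n0 + k)))" by (simp add: ac_simps)
    then have "r * ?c \<le> a (Suc (Suc (n0 + k)))" using Suc by simp
    then show ?case using c by simp
  qed
  show ?thesis
  proof (rule growth[of r n0])
    show "r * a n \<le> a (Suc n)" if "n0 \<le> n" for n
      using step[of "n - n0"] that by simp
    show "0 < a n" for n
      using step[of "n - n0"] pos[of n] by (cases "n \<le> n0") auto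
  qed (rule r)
qed

text \<open>
  A bounded set is not weakly dense: pairing with \<open>g\<close> separates it from a large multiple of \<open>g\<close>.
\<close>

lemma not_weakly_dense_if_bounded:
  fixes x :: "nat \<Rightarrow> 'a \<Rightarrow> complex"
  assumes x: "\<And>n. x n \<in> L2_fun M" and bd: "\<And>n. L2_fun_norm M (x n) \<le> C"
    and g: "g \<in> L2_fun M" "0 < L2_fun_norm M g"
  shows "\<exists>G\<in>L2 M. G \<notin> L2_weak_topology M closure_of (range (\<lambda>n. L2_class M (x n)))"
proof -
  define N where "N = L2_fun_norm M g"
  \<comment> \<open>With this factor the multiple \<open>t g\<close> has norm \<open>C + 1\<close>.\<close>
  define t where "t = (C + 1) / N"
  define \<Lambda> where "\<Lambda> f = L2_inner M f g" for f
  define y where "y s = of_real t * g s" for s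
  have \<Lambda>: "L2_functional M \<Lambda>"
    unfolding \<Lambda>_def[abs_def] by (rule L2_functional_inner) (rule g)
  have y: "y \<in> L2_fun M" unfolding y_def by (rule L2_fun_scale) (rule g)
  have C: "0 \<le> C" using bd[of 0] L2_fun_norm_nonneg[of M "x 0"] by linarith
  have N: "0 < N" using g by (simp add: N_def)
  have "\<Lambda> y = of_real (t * N\<^sup>2)"
    using g by (simp add: \<Lambda>_def y_def[abs_def] L2_inner_scale L2_inner_self N_def)
  also have "t * N\<^sup>2 = (C + 1) * N" using N by (simp add: t_def power2_eq_square)
  finally have \<Lambda>y: "C * N < cmod (\<Lambda> y)" using N C by (simp add: norm_mult)
  have "L2_class M y \<notin> L2_weak_topology M closure_of (range (\<lambda>n. L2_class M (x n)))"
  proof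
    assume "L2_class M y \<in> L2_weak_topology M closure_of (range (\<lambda>n. L2_class M (x n)))"
    moreover have "open {w. C * N < cmod w}"
      by (intro open_Collect_less continuous_intros)
    ultimately have "\<exists>F\<in>range (\<lambda>n. L2_class M (x n)). \<forall>i\<in>{()}. L2_lift \<Lambda> F \<in> {w. C * N < cmod w}"
      using \<Lambda>y by (intro weak_closure_approx)
        (auto simp: L2_lift_in_dual[OF \<Lambda>] L2_class_in_L2[OF y] L2_lift_class[OF \<Lambda> y])
    then obtain n where "C * N < cmod (\<Lambda> (x n))"
      by (auto simp: L2_lift_class[OF \<Lambda> x])
    also have "\<dots> \<le> L2_fun_norm M (x n) * N"
      unfolding \<Lambda>_def N_def by (rule L2_inner_CS[OF x g(1)])
    also have "\<dots> \<le> C * N" using bd[of n] N by (simp add: mult_right_mono)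
    finally show False by simp
  qed
  then show ?thesis using L2_class_in_L2[OF y] by blast
qed

text \<open>
  If the norms eventually grow by a factor \<open>r > 1\<close>, then \<open>0\<close> is not in the weak closure.  For \<open>r\<^sup>p > 5\<close>
  the tail of the sequence splits into \<open>p\<close> subsequences, each of which is kept away from \<open>0\<close> by one
  functional; each of the finitely many remaining vectors is kept away from \<open>0\<close> by the pairing with
  itself.
\<close>

lemma not_weakly_dense_if_geometric_growth:
  assumes x: "\<And>n. x n \<in> L2_fun M" and pos: "\<And>n. 0 < L2_fun_norm M (x n)"
    and r: "1 < r" and growth: "\<And>n. n0 \<le> n \<Longrightarrow> r * L2_fun_norm M (x n) \<le> L2_fun_norm M (x (Suc n))"
  shows "\<exists>G\<in>L2 M. G \<notin> L2_weak_topology M closure_of (range (\<lambda>n. L2_class M (x n)))"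
proof -
  obtain p where p: "5 < r ^ p" using real_arch_pow[OF r] by blast
  have "0 < p" using p by (cases p) auto
  define z where "z j k = x (n0 + j + k * p)" for j k
  have "\<exists>\<Lambda>. L2_functional M \<Lambda> \<and> (\<forall>k. 1 / 2 \<le> cmod (\<Lambda> (z j k)))" for j
  proof (rule L2_functional_bounded_below)
    fix k
    let ?n = "n0 + j + k * p"
    have "r ^ p * L2_fun_norm M (x (n0 + (j + k * p))) \<le> L2_fun_norm M (x (n0 + (j + k * p + p)))"
      using r growth by (intro geometric_lower_bound[of r "\<lambda>n. L2_fun_norm M (x (n0 + n))"]) auto
    moreover have "5 * L2_fun_norm M (x ?n) \<le> r ^ p * L2_fun_norm M (x ?n)"
      using p L2_fun_norm_nonneg by (intro mult_right_mono) auto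
    ultimately show "5 * L2_fun_norm M (z j k) \<le> L2_fun_norm M (z j (Suc k))"
      by (simp add: z_def ac_simps)
  qed (auto simp: z_def x pos)
  then obtain \<Phi> where \<Phi>: "L2_functional M (\<Phi> j)" "1 / 2 \<le> cmod (\<Phi> j (z j k))" for j k
    by metis
  \<comment> \<open>The functionals with index \<open>i < p\<close> handle the residue classes of the tail, the functional with
    index \<open>p + n\<close> handles the vector \<open>x n\<close>.\<close>
  define L where "L i = (if i < p then \<Phi> i else (\<lambda>f. L2_inner M f (x (i - p))))" for i
  define \<epsilon> where "\<epsilon> i = (if i < p then 1 / 2 else (L2_fun_norm M (x (i - p)))\<^sup>2)" for i
  have L: "L2_functional M (L i)" for i
    by (simp add: L_def \<Phi>(1) L2_functional_inner x)
  have eps: "0 < \<epsilon> i" for i using pos[of "i - p"] by (simp add: \<epsilon>_def)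
  have zero: "(\<lambda>x. 0) \<in> L2_fun M" by (simp add: L2_fun_def)
  have L0: "L i (\<lambda>x. 0) = 0" for i
  proof -
    have "\<forall>f\<in>L2_fun M. L i (\<lambda>x. 0 * f x) = 0 * L i f"
      using L[of i] unfolding L2_functional_def by blast
    from bspec[OF this zero] show ?thesis by simp
  qed
  have "L2_class M (\<lambda>x. 0) \<notin> L2_weak_topology M closure_of (range (\<lambda>n. L2_class M (x n)))"
  proof
    assume *: "L2_class M (\<lambda>x. 0) \<in> L2_weak_topology M closure_of (range (\<lambda>n. L2_class M (x n)))"
    have "\<exists>F\<in>range (\<lambda>n. L2_class M (x n)). \<forall>i\<in>{..<p + n0}. L2_lift (L i) F \<in> ball 0 (\<epsilon> i)"
    proof (rule weak_closure_approx[OF *])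
      show "L2_lift (L i) (L2_class M (\<lambda>x. 0)) \<in> ball 0 (\<epsilon> i)" for i
        by (simp add: L2_lift_class[OF L zero] L0 eps)
    qed (use \<open>0 < p\<close> in \<open>auto simp: L2_class_in_L2[OF zero] L2_lift_in_dual[OF L]\<close>)
    then obtain n where n: "\<And>i. i < p + n0 \<Longrightarrow> cmod (L i (x n)) < \<epsilon> i"
      by (auto simp: L2_lift_class[OF L x])
    show False
    proof (cases "n < n0")
      case True
      then show False
        using n[of "p + n"] by (simp add: L_def \<epsilon>_def L2_inner_self[OF x] del: of_real_power)
    next
      case False
      define j where "j = (n - n0) mod p"
      have j: "j < p" using \<open>0 < p\<close> by (simp add: j_def)
      have "x n = z j ((n - n0) div p)"
        using False by (simp add: z_def j_def add.assoc)
      then show False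
        using n[of j] \<Phi>(2)[of j "(n - n0) div p"] j by (simp add: L_def \<epsilon>_def)
    qed
  qed
  then show ?thesis using L2_class_in_L2[OF zero] by blast
qed

section \<open>Orbits of weighted composition operators\<close>

context weighted_composition
begin

text \<open>
  The weighted composition operator on functions.
\<close>

definition W :: "('a \<Rightarrow> complex) \<Rightarrow> 'a \<Rightarrow> complex" where
  "W f x = complex_of_real (u x) * f (\<phi> x)"

lemma W_measurable:
  assumes [measurable]: "f \<in> borel_measurable M"
  shows "W f \<in> borel_measurable M"
  unfolding W_def[abs_def] by measurable

lemma AE_comp:
  assumes "AE x in M. P x"
  shows "AE x in M. P (\<phi> x)"
proof -
  have "AE x in distr M M \<phi>. P x"
    using nonsingular assms unfolding nonsingular_map_def
    by (intro absolutely_continuous_AE[of "distr M M \<phi>" M]) auto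
  then show ?thesis by (rule AE_distrD[OF map_measurable])
qed

lemma W_cong: "AE x in M. f x = g x \<Longrightarrow> AE x in M. W f x = W g x"
  unfolding W_def by (drule AE_comp) (auto elim: eventually_mono)

text \<open>
  A bounded operator maps the class of \<open>f\<close> to an element of \<open>L\<^sup>2(\<mu>)\<close>, which is nonempty; as a function
  that is not square-integrable has the empty class, \<open>W f\<close> is square-integrable.
\<close>

lemma W_in_L2_fun:
  assumes bounded: "L2_bounded_operator M (weighted_comp_op M u \<phi>)" and f: "f \<in> L2_fun M"
  shows "W f \<in> L2_fun M"
proof -
  have "weighted_comp_op M u \<phi> (L2_class M f) \<in> L2 M"
    using bounded L2_class_in_L2[OF f] by (auto simp: L2_bounded_operator_def)
  then obtain g where "g \<in> L2_fun M" "weighted_comp_op M u \<phi> (L2_class M f) = L2_class M g"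
    by (rule L2_cases)
  then have "weighted_comp_op M u \<phi> (L2_class M f) \<noteq> {}"
    using L2_class_self by blast
  then obtain f' where f': "f' \<in> L2_class M f" and "L2_class M (W f') \<noteq> {}"
    by (auto simp: weighted_comp_op_def W_def[abs_def])
  then have Wf': "W f' \<in> L2_fun M" by (auto simp: mem_L2_class)
  have "AE x in M. W f x = W f' x" using f' by (intro W_cong) (simp add: mem_L2_class)
  then have "AE x in M. (cmod (W f' x))\<^sup>2 = (cmod (W f x))\<^sup>2"
    by eventually_elim simp
  moreover note [measurable] = L2_funD(1)[OF Wf'] W_measurable[OF L2_funD(1)[OF f]]
  ultimately have "integrable M (\<lambda>x. (cmod (W f x))\<^sup>2)"
    using L2_funD(2)[OF Wf'] by (subst (asm) integrable_cong_AE) auto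
  then show ?thesis by (simp add: L2_fun_def)
qed

lemma weighted_comp_op_class:
  assumes bounded: "L2_bounded_operator M (weighted_comp_op M u \<phi>)" and f: "f \<in> L2_fun M"
  shows "weighted_comp_op M u \<phi> (L2_class M f) = L2_class M (W f)"
proof -
  have "L2_class M (W f') = L2_class M (W f)" if "f' \<in> L2_class M f" for f'
    using that by (intro L2_class_eq) (simp add: mem_L2_class W_in_L2_fun[OF bounded] W_cong)
  moreover have "weighted_comp_op M u \<phi> (L2_class M f) = (\<Union>f'\<in>L2_class M f. L2_class M (W f'))"
    by (simp add: weighted_comp_op_def W_def[abs_def])
  ultimately show ?thesis using L2_class_self[OF f] by blast
qed

text \<open>
  Applied to the iterates \<open>f, W f, W\<^sup>2 f, \<dots>\<close>, this says that the norms along an orbit are log-convex.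
\<close>

lemma W_norm_log_convex:
  assumes bounded: "L2_bounded_operator M (weighted_comp_op M u \<phi>)"
    and supp: "AE x in M. u x \<noteq> 0 \<longrightarrow> weighted_J M u \<phi> x \<noteq> 0"
    and le: "AE x in M. comp_RN M \<phi> (\<phi> x) * comp_cond_exp M \<phi>
             (\<lambda>y. if u y = 0 then 0 else ennreal (\<bar>u y\<bar>\<^sup>2) / weighted_J M u \<phi> y) x \<le> 1"
    and f: "f \<in> L2_fun M"
  shows "(L2_fun_norm M (W f))\<^sup>2 \<le> L2_fun_norm M (W (W f)) * L2_fun_norm M f"
proof -
  note Wf = W_in_L2_fun[OF bounded f]
  note WWf = W_in_L2_fun[OF bounded Wf]
  have [measurable]: "f \<in> borel_measurable M" by (rule L2_funD[OF f])
  have sq: "(cmod (W f x))\<^sup>2 = (u x * cmod (f (\<phi> x)))\<^sup>2"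
    "(cmod (W (W f) x))\<^sup>2 = (u x * (u (\<phi> x) * cmod (f (\<phi> (\<phi> x)))))\<^sup>2" for x
    by (simp_all add: W_def norm_mult power_mult_distrib)
  have "(\<integral>\<^sup>+x. ennreal ((u x * cmod (f (\<phi> x)))\<^sup>2) \<partial>M)\<^sup>2
     \<le> (\<integral>\<^sup>+x. ennreal ((u x * (u (\<phi> x) * cmod (f (\<phi> (\<phi> x)))))\<^sup>2) \<partial>M)
        * (1 * (\<integral>\<^sup>+x. ennreal ((cmod (f x))\<^sup>2) \<partial>M))"
  proof (rule nn_integral_weight_comp_squared_le[OF supp le])
    show "(\<integral>\<^sup>+x. ennreal ((u x * (u (\<phi> x) * cmod (f (\<phi> (\<phi> x)))))\<^sup>2) \<partial>M) \<noteq> \<infinity>"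
      using nn_integral_L2_fun[OF WWf] unfolding sq by simp
  qed measurable
  then have "ennreal (((L2_fun_norm M (W f))\<^sup>2)\<^sup>2)
      \<le> ennreal ((L2_fun_norm M (W (W f)))\<^sup>2 * (L2_fun_norm M f)\<^sup>2)"
    unfolding sq[symmetric]
    by (simp add: nn_integral_L2_fun f Wf WWf ennreal_power ennreal_mult)
  then have "((L2_fun_norm M (W f))\<^sup>2)\<^sup>2 \<le> (L2_fun_norm M (W (W f)) * L2_fun_norm M f)\<^sup>2"
    by (simp add: power_mult_distrib)
  then show ?thesis
    by (rule power2_le_imp_le) (simp add: L2_fun_norm_nonneg)
qed

end

theorem corollary3p6:
  fixes M :: "'a measure" and \<phi> :: "'a \<Rightarrow> 'a" and u :: "'a \<Rightarrow> real" and l :: real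
  assumes "sigma_finite_measure M"
    and "nonsingular_map M \<phi>"
    and "sigma_finite_subalgebra M (pullback_algebra M \<phi>)"
    and "u \<in> borel_measurable M"
    and "\<And>x. x \<in> space M \<Longrightarrow> 0 \<le> u x"
    and "L2_infinite_dimensional M"
    and "L2_bounded_operator M (weighted_comp_op M u \<phi>)"
    and "0 < l" and "l \<le> 1"
    and "AE x in M. u x \<noteq> 0 \<longrightarrow> weighted_J M u \<phi> x \<noteq> 0"
    and "AE x in M. comp_RN M \<phi> (\<phi> x) *
           comp_cond_exp M \<phi>
             (\<lambda>y. if u y = 0 then 0 else ennreal (\<bar>u y\<bar>\<^sup>2) / weighted_J M u \<phi> y) x
         \<le> ennreal l"
  shows "\<not> L2_weakly_hypercyclic M (weighted_comp_op M u \<phi>)"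
proof
  interpret weighted_composition M \<phi> u
    using assms(1-4) by (rule weighted_composition.intro)
  let ?T = "weighted_comp_op M u \<phi>"
  assume "L2_weakly_hypercyclic M ?T"
  then obtain F where F: "F \<in> L2 M"
    and dense: "L2_weak_topology M closure_of (range (\<lambda>n. (?T ^^ n) F)) = L2 M"
    by (auto simp: L2_weakly_hypercyclic_def)
  obtain f where f: "f \<in> L2_fun M" "F = L2_class M f"
    using F by (rule L2_cases)
  define x where "x n = (W ^^ n) f" for n
  have x: "x n \<in> L2_fun M" for n
    by (induction n) (auto simp: x_def f W_in_L2_fun[OF assms(7)])
  have orbit: "(?T ^^ n) F = L2_class M (x n)" for n
  proof (induction n)
    case (Suc n)
    then show ?case
      using weighted_comp_op_class[OF assms(7) x[of n]] by (simp add: x_def)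
  qed (simp add: x_def f)
  have le1: "AE x in M. comp_RN M \<phi> (\<phi> x) * comp_cond_exp M \<phi>
      (\<lambda>y. if u y = 0 then 0 else ennreal (\<bar>u y\<bar>\<^sup>2) / weighted_J M u \<phi> y) x \<le> 1"
    using assms(11)
  proof eventually_elim
    case (elim x)
    also have "ennreal l \<le> 1" using assms(9) by simp
    finally show ?case .
  qed
  have convex: "(L2_fun_norm M (x (Suc n)))\<^sup>2
      \<le> L2_fun_norm M (x (Suc (Suc n))) * L2_fun_norm M (x n)" for n
    using W_norm_log_convex[OF assms(7,10) le1 x[of n]] by (simp add: x_def)
  have "\<exists>G\<in>L2 M. G \<notin> L2_weak_topology M closure_of (range (\<lambda>n. L2_class M (x n)))"
    using L2_fun_norm_nonneg convex
  proof (rule log_convex_dichotomy[of "\<lambda>n. L2_fun_norm M (x n)"], goal_cases)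
    case 1
    obtain g where "g \<in> L2_fun M" "0 < L2_fun_norm M g"
      using assms(6) by (rule L2_nontrivial)
    with 1 x show ?case by (intro not_weakly_dense_if_bounded)
  next
    case (2 r n0)
    with x show ?case by (intro not_weakly_dense_if_geometric_growth)
  qed
  then show False using dense by (simp add: orbit)
qed

end
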